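(* Let $c\ge1$ and let $f=h+\overline{g}$ be a sense-preserving harmonic mapping defined in the unit disc $\mathbb{D}$ such that $h$ is a conformal $c$-linearly connected mapping and the dilatation $\omega=g'/h'$ satisfies $\|\omega\|_\infty<1/c$. Let $\beta$ be the order of $h$. Then for any $a,b\in\mathbb{D}$, $$|f(a)-f(b)|\ge(1-c\|\omega\|_\infty)\frac{1}{2\beta}\left(1-\exp(-2\beta d(a,b))\right)\sqrt{R_h(a)R_h(b)},$$ and $$|f(a)-f(b)|\le(1+c\|\omega\|_\infty)\frac{1}{2\beta}\left(\exp(2\beta d(a,b))-1\right)\sqrt{R_h(a)R_h(b)}.$$
   Context: $\mathbb{D}=\{z\in\mathbb{C}:|z|<1\}$. A harmonic mapping on $\mathbb{D}$ is written $f=h+\overline{g}$ with $h,g$ analytic in $\mathbb{D}$ and $g(0)=0$. It is sense-preserving (and locally univalent) if its Jacobian $|h'|^2-|g'|^2$ is positive throughout $\mathbb{D}$; then $h'\neq0$ and the dilatation $\omega=g'/h'$ is analytic in $\mathbb{D}$ with $|\omega|<1$. $\|\omega\|_\infty=\sup_{z\in\mathbb{D}}|\omega(z)|$. Conformal means analytic and injective. A conformal mapping $h$ of $\mathbb{D}$ is $c$-linearly connected if for any $a,b\in\mathbb{D}$ there exists a curve $\gamma\subset h(\mathbb{D})$ joining $h(a)$ to $h(b)$ whose length satisfies $\ell_\gamma\le c\,|h(a)-h(b)|$. The order of a locally univalent analytic function $\varphi$ in $\mathbb{D}$ is $\sup_{z\in\mathbb{D}}\left|\frac12\frac{\varphi''(z)}{\varphi'(z)}(1-|z|^2)-\overline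 z\right|$. For $a,b\in\mathbb{D}$, $\rho(a,b)=\left|\frac{a-b}{1-\overline{a}b}\right|$ and $d(a,b)=\tanh^{-1}(\rho(a,b))=\frac12\log\frac{1+\rho(a,b)}{1-\rho(a,b)}$. $R_h(z)=(1-|z|^2)|h'(z)|$. *)

theory Defs
  imports "HOL-Complex_Analysis.Complex_Analysis"
begin

abbreviation unit_disc :: "complex set" where
  "unit_disc \<equiv> ball 0 1"

definition harmonic_mapping :: "(complex \<Rightarrow> complex) \<Rightarrow> (complex \<Rightarrow> complex) \<Rightarrow> (complex \<Rightarrow> complex) \<Rightarrow> bool" where
  "harmonic_mapping f h g \<longleftrightarrow>
     h holomorphic_on unit_disc \<and> g holomorphic_on unit_disc \<and> g 0 = 0 \<and>
     (\<forall>z\<in>unit_disc. f z = h z + cnj (g z))"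

definition jacobian :: "(complex \<Rightarrow> complex) \<Rightarrow> (complex \<Rightarrow> complex) \<Rightarrow> complex \<Rightarrow> real" where
  "jacobian h g z = (norm (deriv h z))\<^sup>2 - (norm (deriv g z))\<^sup>2"

definition sense_preserving :: "(complex \<Rightarrow> complex) \<Rightarrow> (complex \<Rightarrow> complex) \<Rightarrow> bool" where
  "sense_preserving h g \<longleftrightarrow> (\<forall>z\<in>unit_disc. jacobian h g z > 0)"

definition dilatation :: "(complex \<Rightarrow> complex) \<Rightarrow> (complex \<Rightarrow> complex) \<Rightarrow> complex \<Rightarrow> complex" where
  "dilatation h g z = deriv g z / deriv h z"

(* A real supremum: only meaningful for functions bounded on the disc. Dilatations of
   sense-preserving mappings are bounded by 1. *)
definition disc_sup_norm :: "(complex \<Rightarrow> complex) \<Rightarrow> real" where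
  "disc_sup_norm \<omega> = (SUP z\<in>unit_disc. norm (\<omega> z))"

definition conformal_on_disc :: "(complex \<Rightarrow> complex) \<Rightarrow> bool" where
  "conformal_on_disc h \<longleftrightarrow> h holomorphic_on unit_disc \<and> inj_on h unit_disc"

(* Length of a curve parametrised by [0,1] as the supremum of the lengths of inscribed
   polygons over all partitions 0 = t 0 \<le> ... \<le> t n = 1; it is \<infinity> for a
   non-rectifiable curve. *)
definition curve_length :: "(real \<Rightarrow> complex) \<Rightarrow> ereal" where
  "curve_length \<gamma> =
     (SUP (n, t)\<in>{(n::nat, t::nat \<Rightarrow> real). t 0 = 0 \<and> t n = 1 \<and> mono_on {..n} t}.
        ereal (\<Sum>i<n. dist (\<gamma> (t i)) (\<gamma> (t (Suc i)))))"

definition linearly_connected :: "real \<Rightarrow> (complex \<Rightarrow> complex) \<Rightarrow> bool" where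
  "linearly_connected c h \<longleftrightarrow>
     (\<forall>a\<in>unit_disc. \<forall>b\<in>unit_disc. \<exists>\<gamma>.
        path \<gamma> \<and> path_image \<gamma> \<subseteq> h ` unit_disc \<and>
        pathstart \<gamma> = h a \<and> pathfinish \<gamma> = h b \<and>
        curve_length \<gamma> \<le> ereal (c * norm (h a - h b)))"

(* A real supremum, so only meaningful for maps of finite order; univalent maps have
   order at most 2. *)
definition order_of_map :: "(complex \<Rightarrow> complex) \<Rightarrow> real" where
  "order_of_map \<phi> =
     (SUP z\<in>unit_disc. norm ((1/2) * (deriv (deriv \<phi>) z / deriv \<phi> z) * of_real (1 - (norm z)\<^sup>2) - cnj z))"

definition pseudohyp_dist :: "complex \<Rightarrow> complex \<Rightarrow> real" where
  "pseudohyp_dist a b = norm ((a - b) / (1 - cnj a * b))"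

definition hyp_dist :: "complex \<Rightarrow> complex \<Rightarrow> real" where
  "hyp_dist a b = artanh (pseudohyp_dist a b)"

definition conf_radius :: "(complex \<Rightarrow> complex) \<Rightarrow> complex \<Rightarrow> real" where
  "conf_radius h z = (1 - (norm z)\<^sup>2) * norm (deriv h z)"

end

(* Write G for the composite of g with the inverse of h. Its derivative is the dilatation
   transported to the image of h, so integrating along the curve provided by linear connectedness gives
   |g a - g b| \<le> c ||dilatation|| |h a - h b|, and it remains to bound |h a - h b|.
   For this, precompose h with the disc automorphism sending 0 to a; this preserves both the order
   and the conformal radius. The logarithm of the conformal radius changes along radii at rate at most
   2 \<beta> in hyperbolic length, and integrating the resulting bounds for the derivative (along a radius for
   the upper estimate, along the preimage of a segment for the lower one) gives the two bounds with the
   conformal radius at a. By symmetry they hold with the one at b, hence with their geometric mean.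
   The real supremum defining the order is meaningful because univalent maps have finite order. *)
theory Submission
  imports Defs
begin

section \<open>Growth of the conformal radius along radii\<close>

lemma has_real_derivative_norm:
  fixes p :: "real \<Rightarrow> 'a::real_inner"
  assumes "(p has_vector_derivative p') (at t)" "p t \<noteq> 0"
  shows "((\<lambda>t. norm (p t)) has_real_derivative inner (sgn (p t)) p') (at t)"
proof -
  have "(norm has_derivative (\<lambda>h. inner (sgn (p t)) h)) (at (p t))"
    using has_derivative_norm[OF assms(2)] by (simp add: inner_commute)
  from vector_derivative_diff_chain_within[OF assms(1) has_derivative_at_withinI[OF this]]
  show ?thesis
    by (simp add: has_real_derivative_iff_has_vector_derivative comp_def)
qed

text \<open>This is the real part of the logarithmic derivative, obtained without choosing a branch
  of the logarithm along the curve.\<close>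

lemma has_real_derivative_ln_norm:
  fixes p :: "real \<Rightarrow> complex"
  assumes "(p has_vector_derivative p') (at t)" "p t \<noteq> 0"
  shows "((\<lambda>t. ln (norm (p t))) has_real_derivative Re (p' / p t)) (at t)"
proof -
  have "inner (sgn (p t)) p' / norm (p t) = Re (p' / p t)"
    unfolding sgn_div_norm inner_complex_def Re_divide
    by (simp add: cmod_power2[symmetric] divide_simps) (simp add: algebra_simps power2_eq_square)
  then show ?thesis
    using DERIV_chain2[OF DERIV_ln_divide has_real_derivative_norm[OF assms]] assms(2)
    by simp
qed

text \<open>At points where \<open>deriv \<phi>\<close> does not vanish, this is H''(0) / (2 H'(0))
  for the Koebe transform H of \<open>\<phi>\<close>, that is, for \<open>\<phi>\<close> composed
  with the disc automorphism sending 0 to \<open>z\<close>.\<close>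

definition order_op :: "(complex \<Rightarrow> complex) \<Rightarrow> complex \<Rightarrow> complex" where
  "order_op \<phi> z = (1/2) * (deriv (deriv \<phi>) z / deriv \<phi> z) * of_real (1 - (norm z)\<^sup>2) - cnj z"

lemma norm_scaled_lt_1:
  fixes u :: complex
  assumes "norm u = 1" "0 \<le> t" "t < 1"
  shows "norm (of_real t * u) < 1"
  using assms by (simp add: norm_mult)

text \<open>Along a radius, the logarithmic derivative of the conformal radius is
  \<open>2 Re (u A(t u)) / (1 - t\<^sup>2)\<close>, where \<open>A\<close> is the expression whose supremum is the order.\<close>

lemma ln_conf_radius_le:
  assumes hol: "H holomorphic_on unit_disc" and nz: "\<And>z. z \<in> unit_disc \<Longrightarrow> deriv H z \<noteq> 0"
    and bd: "\<And>z. z \<in> unit_disc \<Longrightarrow> norm (order_op H z) \<le> \<beta>" and z: "z \<in> unit_disc"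
  shows "\<bar>ln (conf_radius H z) - ln (conf_radius H 0)\<bar> \<le> 2 * \<beta> * artanh (norm z)"
proof (cases "z = 0")
  case False
  define u where "u = sgn z"
  have u: "norm u = 1" "z = of_real (norm z) * u"
    using False by (simp_all add: u_def sgn_eq norm_divide)
  define L where "L = (\<lambda>t::real. ln (1 - t\<^sup>2) + ln (norm (deriv H (of_real t * u))))"
  define L' where "L' = (\<lambda>t::real. - 2 * t / (1 - t\<^sup>2) +
     Re (u * deriv (deriv H) (of_real t * u) / deriv H (of_real t * u)))"
  have inD: "of_real t * u \<in> unit_disc" if "0 \<le> t" "t < 1" for t :: real
    using norm_scaled_lt_1[OF u(1) that] by simp
  have t2: "t\<^sup>2 < 1" if "0 \<le> t" "t < 1" for t :: real
    using that by (simp add: power_less_one_iff abs_square_less_1)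
  have dL: "(L has_real_derivative L' t) (at t)" if t: "0 \<le> t" "t < 1" for t
  proof -
    have "((\<lambda>t. deriv H (of_real t * u)) has_vector_derivative u * deriv (deriv H) (of_real t * u)) (at t)"
    proof -
      have "((\<lambda>t. of_real t * u) has_vector_derivative u) (at t)"
        by (auto intro!: derivative_eq_intros)
      from field_vector_diff_chain_at[OF this holomorphic_derivI[OF holomorphic_deriv[OF hol] _ inD[OF t]]]
      show ?thesis by (simp add: comp_def)
    qed
    note ln_norm = has_real_derivative_ln_norm[OF this nz[OF inD[OF t]]]
    have "((\<lambda>t. ln (1 - t\<^sup>2)) has_real_derivative - 2 * t / (1 - t\<^sup>2)) (at t)"
      using t2[OF t] by (auto intro!: derivative_eq_intros)
    from DERIV_add[OF this ln_norm] show ?thesis unfolding L_def L'_def .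
  qed
  have L'_bd: "norm (L' t) \<le> 2 * \<beta> / (1 - t\<^sup>2)" if t: "0 \<le> t" "t < 1" for t
  proof -
    have uu: "u * cnj u = 1" using u(1) by (simp add: complex_norm_square[symmetric])
    have n: "norm (of_real t * u) = t" using u(1) t by (simp add: norm_mult)
    have pos: "1 - t\<^sup>2 > 0" using t2[OF t] by simp
    define q where "q = deriv (deriv H) (of_real t * u) / deriv H (of_real t * u)"
    \<comment> \<open>Multiplying by \<open>u\<close> turns the conjugate of the point
      \<open>t u\<close> into the real number \<open>t\<close>, which accounts for the derivative of
      \<open>ln (1 - t^2)\<close>.\<close>
    have "u * order_op H (of_real t * u) = of_real ((1 - t\<^sup>2) / 2) * (u * q) - of_real t * (u * cnj u)"
      unfolding order_op_def n q_def[symmetric] by (simp add: algebra_simps)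
    then have "Re (u * order_op H (of_real t * u)) = (1 - t\<^sup>2) / 2 * Re (u * q) - t"
      unfolding uu by simp
    moreover have "L' t = - 2 * t / (1 - t\<^sup>2) + Re (u * q)" by (simp add: L'_def q_def)
    ultimately have "L' t = 2 / (1 - t\<^sup>2) * Re (u * order_op H (of_real t * u))"
      using pos by (simp add: field_simps)
    moreover have "\<bar>Re (u * order_op H (of_real t * u))\<bar> \<le> \<beta>"
      using abs_Re_le_cmod[of "u * order_op H (of_real t * u)"] bd[OF inD[OF t]] u(1)
      by (simp add: norm_mult)
    ultimately show ?thesis using pos by (simp add: abs_mult field_simps)
  qed
  have zlt: "norm z < 1" using z by simp
  \<comment> \<open>The mean value inequality with comparison function
    \<open>2 * \<beta> * artanh t\<close>, whose derivative is \<open>2 * \<beta>\<close> times the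
    hyperbolic density \<open>1 / (1 - t^2)\<close>.\<close>
  have "norm (L (norm z) - L 0) \<le> 2 * \<beta> * artanh (norm z) - 2 * \<beta> * artanh 0"
  proof (rule differentiable_bound_general)
    show "0 < norm z" using False by simp
    show "continuous_on {0..norm z} L"
      by (rule DERIV_continuous_on[where D = L'], rule has_field_derivative_at_within, rule dL)
         (use zlt in auto)
    show "continuous_on {0..norm z} (\<lambda>t. 2 * \<beta> * artanh t)"
      using zlt by (auto intro!: continuous_intros)
    fix t :: real assume t: "0 < t" "t < norm z"
    show "(L has_vector_derivative L' t) (at t)"
      using dL[of t] t zlt by (simp add: has_real_derivative_iff_has_vector_derivative)
    show "((\<lambda>t. 2 * \<beta> * artanh t) has_vector_derivative 2 * \<beta> / (1 - t\<^sup>2)) (at t)"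
      unfolding has_real_derivative_iff_has_vector_derivative[symmetric]
      using t zlt by (auto intro!: derivative_eq_intros)
    show "norm (L' t) \<le> 2 * \<beta> / (1 - t\<^sup>2)" using L'_bd[of t] t zlt by simp
  qed
  moreover have "L (norm z) = ln (conf_radius H z)" "L 0 = ln (conf_radius H 0)"
    using nz[OF z] nz[of 0] t2[of "norm z"] zlt u(2)[symmetric]
    by (simp_all add: L_def conf_radius_def ln_mult)
  ultimately show ?thesis by simp
qed simp

lemma conf_radius_bounds:
  assumes "H holomorphic_on unit_disc" and nz: "\<And>z. z \<in> unit_disc \<Longrightarrow> deriv H z \<noteq> 0"
    and "\<And>z. z \<in> unit_disc \<Longrightarrow> norm (order_op H z) \<le> \<beta>" and z: "z \<in> unit_disc"
  shows "norm (deriv H 0) * exp (- 2 * \<beta> * artanh (norm z)) \<le> conf_radius H z"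
    and "conf_radius H z \<le> norm (deriv H 0) * exp (2 * \<beta> * artanh (norm z))"
proof -
  have "(norm z)\<^sup>2 < 1" using z by (simp add: power_less_one_iff abs_square_less_1)
  then have pos: "conf_radius H z > 0" "conf_radius H 0 > 0"
    using nz[OF z] nz[of 0] by (simp_all add: conf_radius_def)
  have *: "\<bar>ln (conf_radius H z) - ln (conf_radius H 0)\<bar> \<le> 2 * \<beta> * artanh (norm z)"
    using assms by (rule ln_conf_radius_le)
  have c0: "conf_radius H 0 = norm (deriv H 0)" by (simp add: conf_radius_def)
  have "conf_radius H 0 * exp (- 2 * \<beta> * artanh (norm z)) = exp (ln (conf_radius H 0) - 2 * \<beta> * artanh (norm z))"
    using pos by (simp add: exp_diff exp_minus divide_inverse)
  also have "\<dots> \<le> exp (ln (conf_radius H z))" using * by simp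
  finally show "norm (deriv H 0) * exp (- 2 * \<beta> * artanh (norm z)) \<le> conf_radius H z"
    using pos c0 by simp
  have "exp (ln (conf_radius H z)) \<le> exp (ln (conf_radius H 0) + 2 * \<beta> * artanh (norm z))"
    using * by simp
  also have "\<dots> = conf_radius H 0 * exp (2 * \<beta> * artanh (norm z))"
    using pos by (simp add: exp_add)
  finally show "conf_radius H z \<le> norm (deriv H 0) * exp (2 * \<beta> * artanh (norm z))"
    using pos c0 by simp
qed

section \<open>Distortion between the origin and another point\<close>

lemma norm_diff_0_le_of_order:
  assumes hol: "H holomorphic_on unit_disc" and nz: "\<And>z. z \<in> unit_disc \<Longrightarrow> deriv H z \<noteq> 0"
    and bd: "\<And>z. z \<in> unit_disc \<Longrightarrow> norm (order_op H z) \<le> \<beta>" and z: "z \<in> unit_disc"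
    and \<beta>: "\<beta> > 0"
  shows "norm (H z - H 0) \<le> norm (deriv H 0) * ((exp (2 * \<beta> * artanh (norm z)) - 1) / (2 * \<beta>))"
proof (cases "z = 0")
  case False
  define u where "u = sgn z"
  have u: "norm u = 1" "z = of_real (norm z) * u"
    using False by (simp_all add: u_def sgn_eq norm_divide)
  have zlt: "norm z < 1" using z by simp
  have inD: "of_real t * u \<in> unit_disc" if "0 \<le> t" "t < 1" for t :: real
    using norm_scaled_lt_1[OF u(1) that] by simp
  \<comment> \<open>A primitive of the upper bound for |H'| at distance \<open>t\<close> from the
    origin, since \<open>artanh\<close> has derivative \<open>1 / (1 - t^2)\<close>.\<close>
  define E where "E = (\<lambda>t. norm (deriv H 0) * (exp (2 * \<beta> * artanh t) / (2 * \<beta>)))"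
  have "norm (H (of_real (norm z) * u) - H (of_real 0 * u)) \<le> E (norm z) - E 0"
  proof (rule differentiable_bound_general)
    show "0 < norm z" using False by simp
    have "continuous_on ((\<lambda>t. complex_of_real t * u) ` {0..norm z}) H"
      using zlt u(1) inD
      by (intro continuous_on_subset[OF holomorphic_on_imp_continuous_on[OF hol]]) (auto simp: norm_mult)
    then show "continuous_on {0..norm z} (\<lambda>t. H (of_real t * u))"
      by (rule continuous_on_compose2) (auto intro!: continuous_intros)
    show "continuous_on {0..norm z} E"
      unfolding E_def using zlt \<beta> by (auto intro!: continuous_intros)
    fix t :: real assume t: "0 < t" "t < norm z"
    have lt: "t < 1" "t\<^sup>2 < 1" using t zlt by (auto simp: power_less_one_iff abs_square_less_1)
    have tD: "of_real t * u \<in> unit_disc" using inD t zlt by simp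
    have "((\<lambda>t. of_real t * u) has_vector_derivative u) (at t)"
      by (auto intro!: derivative_eq_intros)
    from field_vector_diff_chain_at[OF this holomorphic_derivI[OF hol _ tD]]
    show "((\<lambda>t. H (of_real t * u)) has_vector_derivative u * deriv H (of_real t * u)) (at t)"
      by (simp add: comp_def)
    show "(E has_vector_derivative norm (deriv H 0) * (exp (2 * \<beta> * artanh t) / (1 - t\<^sup>2))) (at t)"
      unfolding has_real_derivative_iff_has_vector_derivative[symmetric] E_def
      using t lt \<beta> by (auto intro!: derivative_eq_intros simp: divide_simps)
    show "norm (u * deriv H (of_real t * u)) \<le> norm (deriv H 0) * (exp (2 * \<beta> * artanh t) / (1 - t\<^sup>2))"
      using conf_radius_bounds(2)[OF hol nz bd tD] u(1) t lt
      by (simp add: norm_mult conf_radius_def field_simps)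
  qed
  then show ?thesis unfolding u(2)[symmetric] using \<beta> by (simp add: E_def field_simps)
qed simp

text \<open>Pull back the segment from \<open>H 0\<close> to \<open>H z\<close> by the inverse of \<open>H\<close>, stopping it when the
  preimage first reaches the circle of radius \<open>norm z\<close>. Up to there the segment lies in the image.\<close>

lemma norm_diff_0_ge_of_order:
  assumes hol: "H holomorphic_on unit_disc" and inj: "inj_on H unit_disc"
    and bd: "\<And>z. z \<in> unit_disc \<Longrightarrow> norm (order_op H z) \<le> \<beta>" and z: "z \<in> unit_disc"
    and \<beta>: "\<beta> > 0"
  shows "norm (deriv H 0) * ((1 - exp (- 2 * \<beta> * artanh (norm z))) / (2 * \<beta>)) \<le> norm (H z - H 0)"
proof (cases "z = 0")
  case False
  have nz: "\<And>z. z \<in> unit_disc \<Longrightarrow> deriv H z \<noteq> 0"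
    using holomorphic_injective_imp_regular[OF hol _ inj] by simp
  have H0: "deriv H 0 \<noteq> 0" by (rule nz) simp
  define r where "r = norm z"
  have r: "0 < r" "r < 1" using z False by (auto simp: r_def)
  obtain k where k: "k holomorphic_on H ` unit_disc"
    and dk: "\<And>z. z \<in> unit_disc \<Longrightarrow> deriv H z * deriv k (H z) = 1"
    and kH: "\<And>z. z \<in> unit_disc \<Longrightarrow> k (H z) = z"
    using holomorphic_has_inverse[OF hol _ inj] by (metis open_ball)
  have openHD: "open (H ` unit_disc)" using open_mapping_thm3[OF hol _ inj] by simp
  have sub: "ball 0 r \<subseteq> unit_disc" "cball 0 r \<subseteq> unit_disc" using r by auto
  have openB: "open (H ` ball 0 r)"
    using open_mapping_thm3[of H "ball 0 r"] hol inj sub holomorphic_on_subset inj_on_subset by blast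
  have contH: "continuous_on (cball 0 r) H"
    using continuous_on_subset[OF holomorphic_on_imp_continuous_on[OF hol] sub(2)] .
  have closedC: "closed (H ` cball 0 r)"
    by (intro compact_imp_closed compact_continuous_image contH compact_cball)
  define d where "d = H z - H 0"
  define \<sigma> where "\<sigma> = (\<lambda>t::real. H 0 + of_real t * d)"
  have d0: "d \<noteq> 0" using inj_onD[OF inj, of z 0] z False by (auto simp: d_def)
  have cont\<sigma>: "continuous_on UNIV \<sigma>" unfolding \<sigma>_def by (intro continuous_intros)
  \<comment> \<open>The times at which the segment is outside the image of the open ball. This set
    is closed because that image is open, so its infimum \<open>T\<close> is a first exit
    time.\<close>
  define S where "S = {0..1} \<inter> \<sigma> -` (- (H ` ball 0 r))"
  have closedS: "closed S" unfolding S_def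
    using openB cont\<sigma> by (intro closed_Int closed_vimage) auto
  have "\<sigma> 1 = H z" by (simp add: \<sigma>_def d_def)
  moreover have "H z \<notin> H ` ball 0 r"
    using inj_onD[OF inj] z sub by (force simp: r_def)
  ultimately have S1: "1 \<in> S" by (simp add: S_def)
  have bddS: "bdd_below S" by (rule bdd_belowI[of _ 0]) (auto simp: S_def)
  define T where "T = Inf S"
  have TS: "T \<in> S" unfolding T_def using closed_contains_Inf S1 bddS closedS by blast
  have "0 \<notin> S" using r by (auto simp: S_def \<sigma>_def)
  then have T: "0 < T" "T \<le> 1" using TS by (auto simp: S_def intro: le_neq_trans)
  have before: "\<sigma> t \<in> H ` ball 0 r" if "0 \<le> t" "t < T" for t
  proof -
    have "t \<notin> S" using that cInf_lower[OF _ bddS, of t] by (auto simp: T_def)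
    then show ?thesis using that T by (auto simp: S_def)
  qed
  \<comment> \<open>As a limit of earlier points, \<open>\<sigma> T\<close> lies in the compact
    image of the closed ball. Since it is not in the image of the open ball, its preimage has norm
    exactly \<open>r\<close>.\<close>
  have "closed (\<sigma> -` (H ` cball 0 r))" using closed_vimage[OF closedC] cont\<sigma> by simp
  moreover have "{0..<T} \<subseteq> \<sigma> -` (H ` cball 0 r)"
  proof
    fix t assume "t \<in> {0..<T}"
    then have "\<sigma> t \<in> H ` ball 0 r" using before by simp
    then show "t \<in> \<sigma> -` (H ` cball 0 r)"
      using image_mono[OF ball_subset_cball[of "0::complex" r], of H] by blast
  qed
  ultimately have "closure {0..<T} \<subseteq> \<sigma> -` (H ` cball 0 r)" by (rule closure_minimal[rotated])
  moreover have "T \<in> closure {0..<T}" using T by simp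
  ultimately have "\<sigma> T \<in> H ` cball 0 r" by blast
  then obtain y where y: "norm y \<le> r" "\<sigma> T = H y" by auto
  have yr: "norm y = r" using TS y by (force simp: S_def)
  define w where "w = (\<lambda>t. k (\<sigma> t))"
  have \<sigma>D: "\<sigma> t \<in> H ` unit_disc" if "0 \<le> t" "t \<le> T" for t
  proof (cases "t = T")
    case True
    then show ?thesis using y r by auto
  next
    case False
    then show ?thesis using before[of t] that sub(1) by auto
  qed
  have w0: "w 0 = 0" and wT: "w T = y"
    using kH[of 0] kH[of y] y r by (auto simp: w_def) (simp add: \<sigma>_def)
  have wD: "w t \<in> unit_disc" "H (w t) = \<sigma> t" if "0 \<le> t" "t \<le> T" for t
    using \<sigma>D[OF that] kH by (auto simp: w_def)
  have contw: "continuous_on {0..T} w"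
    unfolding w_def
    by (rule continuous_on_compose2[OF holomorphic_on_imp_continuous_on[OF k]
          continuous_on_subset[OF cont\<sigma>]]) (use \<sigma>D in auto)
  \<comment> \<open>A primitive of \<open>exp (- 2 * \<beta> * artanh x) / (1 - x^2)\<close>, which
    times |H'(0)| is the lower bound for |H'| at distance \<open>x\<close> from the origin.\<close>
  define F where "F = (\<lambda>x. (1 - exp (- 2 * \<beta> * artanh x)) / (2 * \<beta>))"
  have dF: "(F has_real_derivative exp (- 2 * \<beta> * artanh x) / (1 - x\<^sup>2)) (at x)"
    if "0 \<le> x" "x < 1" for x
  proof -
    have "x\<^sup>2 < 1" using that by (simp add: power_less_one_iff abs_square_less_1)
    then show ?thesis
      unfolding F_def using that \<beta> by (auto intro!: derivative_eq_intros simp: divide_simps)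
  qed
  define w' where "w' = (\<lambda>t. d * deriv k (\<sigma> t))"
  define \<phi>' where "\<phi>' = (\<lambda>t. exp (- 2 * \<beta> * artanh (norm (w t))) / (1 - (norm (w t))\<^sup>2) * inner (sgn (w t)) (w' t))"
  \<comment> \<open>From H(w(t)) = \<sigma>(t) follows |H'(w)| |w'| = |d|. The lower bound for |H'|
    therefore makes \<open>F (norm (w t))\<close> grow at rate at most |d| / |H'(0)|.\<close>
  have "norm (F (norm (w T)) - F (norm (w 0))) \<le> T * (norm d / norm (deriv H 0)) - 0 * (norm d / norm (deriv H 0))"
  proof (rule differentiable_bound_general)
    show "0 < T" by (rule T)
    have "continuous_on {0..<1} F"
      by (rule DERIV_continuous_on, rule has_field_derivative_at_within, rule dF) auto
    then show "continuous_on {0..T} (\<lambda>t. F (norm (w t)))"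
      by (rule continuous_on_compose2) (use contw wD in \<open>auto intro!: continuous_intros\<close>)
    show "continuous_on {0..T} (\<lambda>t. t * (norm d / norm (deriv H 0)))" by (intro continuous_intros)
    fix t assume t: "0 < t" "t < T"
    show "((\<lambda>t. t * (norm d / norm (deriv H 0))) has_vector_derivative norm d / norm (deriv H 0)) (at t)"
      using H0 unfolding has_real_derivative_iff_has_vector_derivative[symmetric]
      by (auto intro!: derivative_eq_intros)
    have wt: "w t \<in> unit_disc" "H (w t) = \<sigma> t" using wD t by auto
    \<comment> \<open>The norm is not differentiable at 0, but the preimage curve meets 0 only at
      time 0.\<close>
    have wt0: "w t \<noteq> 0" using wt(2) t d0 by (auto simp: \<sigma>_def)
    have "(\<sigma> has_vector_derivative d) (at t)"
      unfolding \<sigma>_def by (auto intro!: derivative_eq_intros)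
    from field_vector_diff_chain_at[OF this holomorphic_derivI[OF k openHD \<sigma>D]]
    have dw: "(w has_vector_derivative w' t) (at t)"
      using t by (simp add: w_def w'_def comp_def)
    show "((\<lambda>t. F (norm (w t))) has_vector_derivative \<phi>' t) (at t)"
      unfolding has_real_derivative_iff_has_vector_derivative[symmetric] \<phi>'_def
      using DERIV_chain2[OF dF has_real_derivative_norm[OF dw wt0]] wt by simp
    have sq: "(norm (w t))\<^sup>2 < 1" using wt by (simp add: power_less_one_iff abs_square_less_1)
    have "\<bar>inner (sgn (w t)) (w' t)\<bar> \<le> norm (w' t)"
      using Cauchy_Schwarz_ineq2[of "sgn (w t)" "w' t"] wt0 by (simp add: norm_sgn)
    then have "norm (\<phi>' t) \<le> exp (- 2 * \<beta> * artanh (norm (w t))) / (1 - (norm (w t))\<^sup>2) * norm (w' t)"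
      unfolding \<phi>'_def using sq by (simp add: abs_mult divide_right_mono)
    also have "norm (w' t) = norm d / norm (deriv H (w t))"
    proof -
      have "deriv k (\<sigma> t) = 1 / deriv H (w t)"
        using dk[OF wt(1)] nz[OF wt(1)] unfolding wt(2) by (simp add: eq_divide_eq mult.commute)
      then show ?thesis by (simp add: w'_def norm_divide)
    qed
    also have "exp (- 2 * \<beta> * artanh (norm (w t))) / (1 - (norm (w t))\<^sup>2) * (norm d / norm (deriv H (w t)))
        = exp (- 2 * \<beta> * artanh (norm (w t))) / conf_radius H (w t) * norm d"
      by (simp add: conf_radius_def)
    also have "\<dots> \<le> norm d / norm (deriv H 0)"
    proof -
      have "conf_radius H (w t) > 0" using sq nz[OF wt(1)] by (simp add: conf_radius_def)
      then have "exp (- 2 * \<beta> * artanh (norm (w t))) / conf_radius H (w t) \<le> 1 / norm (deriv H 0)"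
        using conf_radius_bounds(1)[OF hol nz bd wt(1)] H0 by (simp add: field_simps)
      from mult_right_mono[OF this norm_ge_zero[of d]] show ?thesis by simp
    qed
    finally show "norm (\<phi>' t) \<le> norm d / norm (deriv H 0)" .
  qed
  moreover have "F 0 = 0" by (simp add: F_def)
  ultimately have "F r \<le> T * (norm d / norm (deriv H 0))"
    by (simp add: w0 wT yr)
  also have "\<dots> \<le> norm d / norm (deriv H 0)"
    using T by (intro mult_left_le_one_le) auto
  finally show ?thesis
    using H0 unfolding F_def d_def r_def by (simp add: field_simps)
qed simp

section \<open>Disc automorphisms and the invariance of conformal radius and order\<close>

lemma Moebius_denom_nonzero:
  fixes a z :: complex
  assumes "norm a < 1" "norm z < 1"
  shows "1 + cnj a * z \<noteq> 0"
proof
  assume "1 + cnj a * z = 0"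
  then have "cnj a * z = - 1" by (simp add: add_eq_0_iff)
  then have "norm a * norm z = 1" by (metis complex_mod_cnj norm_minus_cancel norm_mult norm_one)
  moreover have "norm a * norm z < 1 * 1" using assms by (intro mult_strict_mono') auto
  ultimately show False by simp
qed

text \<open>With parameter \<open>- a\<close> the automorphism sends 0 to \<open>a\<close>; the one
  with parameter \<open>a\<close> is its inverse.\<close>

lemma Moebius_function_0_minus:
  "Moebius_function 0 (- a) z = (z + a) / (1 + cnj a * z)"
  by (simp add: Moebius_function_simple)

lemma has_field_derivative_Moebius:
  assumes "norm a < 1" "norm z < 1"
  shows "(Moebius_function 0 (- a) has_field_derivative
           of_real (1 - (norm a)\<^sup>2) / (1 + cnj a * z)\<^sup>2) (at z)"
proof -
  have n: "1 + cnj a * z \<noteq> 0" using Moebius_denom_nonzero[OF assms] .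
  have "((\<lambda>z. (z + a) / (1 + cnj a * z)) has_field_derivative
      ((1 + cnj a * z) - (z + a) * cnj a) / (1 + cnj a * z)\<^sup>2) (at z)"
    using n by (auto intro!: derivative_eq_intros simp: power2_eq_square)
  moreover have "(1 + cnj a * z) - (z + a) * cnj a = of_real (1 - (norm a)\<^sup>2)"
    unfolding of_real_diff complex_norm_square by (simp add: algebra_simps)
  ultimately show ?thesis unfolding Moebius_function_0_minus[abs_def] by simp
qed

text \<open>Equality in the Schwarz-Pick lemma: the right-hand side is \<open>1 - (norm z)^2\<close>
  times the modulus of the derivative of the automorphism at \<open>z\<close>.\<close>

lemma one_minus_norm_Moebius:
  assumes "norm a < 1" "norm z < 1"
  shows "1 - (norm (Moebius_function 0 (- a) z))\<^sup>2
       = (1 - (norm a)\<^sup>2) * (1 - (norm z)\<^sup>2) / (norm (1 + cnj a * z))\<^sup>2"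
proof -
  have n: "(norm (1 + cnj a * z))\<^sup>2 \<noteq> 0" using Moebius_denom_nonzero[OF assms] by simp
  have "(norm (1 + cnj a * z))\<^sup>2 - (norm (z + a))\<^sup>2 = (1 - (norm a)\<^sup>2) * (1 - (norm z)\<^sup>2)"
    unfolding cmod_power2 by (simp add: power2_eq_square algebra_simps)
  then show ?thesis unfolding Moebius_function_0_minus norm_divide power_divide
    using n by (simp add: field_simps)
qed

lemma Moebius_in_disc:
  assumes "a \<in> unit_disc" "z \<in> unit_disc"
  shows "Moebius_function 0 (- a) z \<in> unit_disc"
  using Moebius_function_norm_lt_1[of "- a" z 0] assms by simp

lemma holomorphic_compose_Moebius:
  assumes "h holomorphic_on unit_disc" "a \<in> unit_disc"
  shows "(\<lambda>z. h (Moebius_function 0 (- a) z)) holomorphic_on unit_disc"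
proof -
  have "Moebius_function 0 (- a) ` unit_disc \<subseteq> unit_disc"
    using Moebius_in_disc[OF assms(2)] by blast
  then show ?thesis
    using holomorphic_on_compose_gen[OF Moebius_function_holomorphic[of "- a" 0] assms(1)] assms(2)
    by (simp add: comp_def)
qed

lemma inj_on_compose_Moebius:
  assumes "inj_on h unit_disc" "a \<in> unit_disc"
  shows "inj_on (\<lambda>z. h (Moebius_function 0 (- a) z)) unit_disc"
proof (rule inj_onI)
  fix x y assume x: "x \<in> unit_disc" and y: "y \<in> unit_disc"
    and eq: "h (Moebius_function 0 (- a) x) = h (Moebius_function 0 (- a) y)"
  have inv: "Moebius_function 0 a (Moebius_function 0 (- a) z) = z" if "z \<in> unit_disc" for z
    using Moebius_function_compose[of a "- a" z] assms(2) that by simp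
  have "Moebius_function 0 (- a) x = Moebius_function 0 (- a) y"
    using inj_onD[OF assms(1) eq] Moebius_in_disc assms(2) x y by blast
  then show "x = y" using inv[OF x] inv[OF y] by metis
qed

lemma deriv_compose_Moebius:
  assumes "h holomorphic_on unit_disc" "a \<in> unit_disc" "z \<in> unit_disc"
  shows "deriv (\<lambda>z. h (Moebius_function 0 (- a) z)) z =
    deriv h (Moebius_function 0 (- a) z) * (of_real (1 - (norm a)\<^sup>2) / (1 + cnj a * z)\<^sup>2)"
  using assms DERIV_chain2[OF holomorphic_derivI[OF assms(1) open_ball] has_field_derivative_Moebius]
  by (intro DERIV_imp_deriv) (auto simp: Moebius_function_norm_lt_1)

lemma deriv_deriv_compose_Moebius:
  assumes "h holomorphic_on unit_disc" "a \<in> unit_disc" "z \<in> unit_disc"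
  shows "deriv (deriv (\<lambda>z. h (Moebius_function 0 (- a) z))) z =
    deriv (deriv h) (Moebius_function 0 (- a) z) * (of_real (1 - (norm a)\<^sup>2) / (1 + cnj a * z)\<^sup>2)\<^sup>2
    - deriv h (Moebius_function 0 (- a) z) * (2 * cnj a * of_real (1 - (norm a)\<^sup>2) / (1 + cnj a * z) ^ 3)"
    (is "_ = ?R")
proof (rule DERIV_imp_deriv)
  define A where "A = complex_of_real (1 - (norm a)\<^sup>2)"
  have n: "1 + cnj a * z \<noteq> 0" using Moebius_denom_nonzero assms by simp
  have 1: "((\<lambda>z. A / (1 + cnj a * z)\<^sup>2) has_field_derivative - (2 * cnj a * A / (1 + cnj a * z) ^ 3)) (at z)"
    using n by (auto intro!: derivative_eq_intros simp: divide_simps power2_eq_square power3_eq_cube)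
  have 2: "((\<lambda>z. deriv h (Moebius_function 0 (- a) z)) has_field_derivative
      deriv (deriv h) (Moebius_function 0 (- a) z) * (A / (1 + cnj a * z)\<^sup>2)) (at z)"
    unfolding A_def
    using assms Moebius_in_disc
    by (intro DERIV_chain2[OF holomorphic_derivI[OF holomorphic_deriv[OF assms(1) open_ball] open_ball]
          has_field_derivative_Moebius]) auto
  have "((\<lambda>z. deriv h (Moebius_function 0 (- a) z) * (A / (1 + cnj a * z)\<^sup>2)) has_field_derivative ?R) (at z)"
    using DERIV_mult[OF 2 1] by (simp add: A_def power2_eq_square algebra_simps)
  then show "(deriv (\<lambda>z. h (Moebius_function 0 (- a) z)) has_field_derivative ?R) (at z)"
    by (rule has_field_derivative_transform_within_open[where S = unit_disc])
       (use assms deriv_compose_Moebius in \<open>auto simp: A_def\<close>)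
qed

text \<open>The chain rule produces the modulus of the derivative of the automorphism, and the
  Schwarz-Pick equality absorbs it.\<close>

lemma conf_radius_compose_Moebius:
  assumes "h holomorphic_on unit_disc" "a \<in> unit_disc" "z \<in> unit_disc"
  shows "conf_radius (\<lambda>z. h (Moebius_function 0 (- a) z)) z = conf_radius h (Moebius_function 0 (- a) z)"
proof -
  have "(norm a)\<^sup>2 < 1" using assms by (simp add: power_less_one_iff abs_square_less_1)
  moreover have "norm (complex_of_real (1 - (norm a)\<^sup>2)) = \<bar>1 - (norm a)\<^sup>2\<bar>" by (rule norm_of_real)
  ultimately show ?thesis
    unfolding conf_radius_def deriv_compose_Moebius[OF assms]
    using one_minus_norm_Moebius[of a z] assms
    by (simp add: norm_mult norm_divide norm_power)
qed

text \<open>The two expressions differ only by the unimodular factor \<open>cnj D / D\<close>, where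
  \<open>D\<close> is the denominator of the automorphism at \<open>z\<close>.\<close>

lemma norm_order_op_compose_Moebius:
  assumes "h holomorphic_on unit_disc" "a \<in> unit_disc" "z \<in> unit_disc"
    and nz: "\<And>z. z \<in> unit_disc \<Longrightarrow> deriv h z \<noteq> 0"
  shows "norm (order_op (\<lambda>z. h (Moebius_function 0 (- a) z)) z) = norm (order_op h (Moebius_function 0 (- a) z))"
proof -
  define m where "m = Moebius_function 0 (- a) z"
  define A where "A = complex_of_real (1 - (norm a)\<^sup>2)"
  define R where "R = complex_of_real (1 - (norm z)\<^sup>2)"
  define D where "D = 1 + cnj a * z"
  define P where "P = deriv (deriv h) m / deriv h m"
  have "D \<noteq> 0" using Moebius_denom_nonzero assms by (simp add: D_def)
  then have D: "D \<noteq> 0" "cnj D \<noteq> 0" by simp_all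
  have hm: "deriv h m \<noteq> 0" using nz Moebius_in_disc assms by (simp add: m_def)
  have "(norm a)\<^sup>2 < 1" using assms by (simp add: power_less_one_iff abs_square_less_1)
  then have A: "A \<noteq> 0" unfolding A_def by (metis diff_gt_0_iff_gt less_irrefl of_real_eq_0_iff)
  have R: "R = 1 - z * cnj z" unfolding R_def of_real_diff complex_norm_square by simp
  have "1 - (norm m)\<^sup>2 = (1 - (norm a)\<^sup>2) * (1 - (norm z)\<^sup>2) / (norm D)\<^sup>2"
    using one_minus_norm_Moebius[of a z] assms by (simp add: m_def D_def)
  then have "complex_of_real (1 - (norm m)\<^sup>2) = A * R / (D * cnj D)"
    by (simp only: A_def R_def of_real_mult of_real_divide complex_norm_square)
  moreover have "cnj m = (cnj z + cnj a) / cnj D"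
    by (simp add: m_def Moebius_function_0_minus D_def)
  ultimately have 1: "order_op h m = (1/2) * P * (A * R / (D * cnj D)) - (cnj z + cnj a) / cnj D"
    by (simp add: order_op_def P_def)
  have "order_op (\<lambda>z. h (Moebius_function 0 (- a) z)) z
    = (1/2) * ((deriv (deriv h) m * (A / D\<^sup>2)\<^sup>2 - deriv h m * (2 * cnj a * A / D ^ 3)) / (deriv h m * (A / D\<^sup>2))) * R - cnj z"
    unfolding order_op_def deriv_compose_Moebius[OF assms(1-3)] deriv_deriv_compose_Moebius[OF assms(1-3)]
    by (simp add: m_def A_def R_def D_def)
  also have "(deriv (deriv h) m * (A / D\<^sup>2)\<^sup>2 - deriv h m * (2 * cnj a * A / D ^ 3)) / (deriv h m * (A / D\<^sup>2))
     = P * A / D\<^sup>2 - 2 * cnj a / D"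
    using D hm A by (simp add: P_def field_simps power2_eq_square power3_eq_cube)
  also have "(1/2) * (P * A / D\<^sup>2 - 2 * cnj a / D) * R - cnj z
     = (1/2) * P * A * R / D\<^sup>2 - (cnj a * R + cnj z * D) / D"
    using D by (simp add: field_simps)
  \<comment> \<open>The second derivative of the automorphism and the term \<open>cnj z\<close>
    combine to the conjugate of the numerator \<open>z + a\<close>, which is what
    \<open>cnj m\<close> contributes on the other side.\<close>
  also have "cnj a * R + cnj z * D = cnj z + cnj a"
    unfolding R by (simp add: D_def algebra_simps)
  also have "(1/2) * P * A * R / D\<^sup>2 - (cnj z + cnj a) / D = cnj D / D * order_op h m"
    unfolding 1 using D by (simp add: field_simps power2_eq_square)
  finally show ?thesis using D by (simp add: norm_mult norm_divide m_def)
qed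

section \<open>Finiteness and positivity of the order of a univalent map\<close>

text \<open>Otherwise the inverse of \<open>H\<close>, bounded by 1, would be holomorphic on a disc
  of radius 2 |H'(0)|, and Cauchy's inequality would bound its derivative at \<open>H 0\<close> by
  half of its actual modulus 1 / |H'(0)|.\<close>

lemma exists_omitted_value:
  assumes hol: "H holomorphic_on unit_disc" and inj: "inj_on H unit_disc"
  obtains w where "w \<notin> H ` unit_disc" "norm (w - H 0) \<le> 2 * norm (deriv H 0)"
proof -
  have "\<exists>w. w \<notin> H ` unit_disc \<and> norm (w - H 0) \<le> 2 * norm (deriv H 0)"
  proof (rule ccontr)
    assume "\<nexists>w. w \<notin> H ` unit_disc \<and> norm (w - H 0) \<le> 2 * norm (deriv H 0)"
    then have sub: "cball (H 0) (2 * norm (deriv H 0)) \<subseteq> H ` unit_disc"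
      by (auto simp: dist_norm norm_minus_commute)
    obtain k where k: "k holomorphic_on H ` unit_disc"
      and dk: "\<And>z. z \<in> unit_disc \<Longrightarrow> deriv H z * deriv k (H z) = 1"
      and kH: "\<And>z. z \<in> unit_disc \<Longrightarrow> k (H z) = z"
      using holomorphic_has_inverse[OF hol _ inj] by (metis open_ball)
    have H0: "deriv H 0 \<noteq> 0" using dk[of 0] by auto
    have "norm ((deriv ^^ 1) k (H 0)) \<le> fact 1 * 1 / (2 * norm (deriv H 0)) ^ 1"
    proof (rule Cauchy_inequality)
      show "k holomorphic_on ball (H 0) (2 * norm (deriv H 0))"
        using sub ball_subset_cball by (blast intro: holomorphic_on_subset[OF k])
      show "continuous_on (cball (H 0) (2 * norm (deriv H 0))) k"
        using holomorphic_on_subset[OF k sub] by (rule holomorphic_on_imp_continuous_on)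
      fix x assume "norm (H 0 - x) = 2 * norm (deriv H 0)"
      then have "x \<in> H ` unit_disc" using sub by (auto simp: dist_norm)
      then show "norm (k x) \<le> 1" using kH by auto
    qed (use H0 in simp)
    moreover have "norm (deriv k (H 0)) = 1 / norm (deriv H 0)"
      using dk[of 0] H0 by (simp add: field_simps flip: norm_mult)
    ultimately show False using H0 by (simp add: field_simps)
  qed
  then show ?thesis using that by blast
qed

text \<open>If \<open>w\<close> is omitted by the univalent map \<open>H\<close>, the branch of the square root of
  \<open>(w - H z) / (w - H 0)\<close> equal to \<open>-1\<close> at the origin omits \<open>0\<close> and, by injectivity, \<open>1\<close>.
  Schottky's theorem then replaces Bieberbach's inequality, at the price of a worse constant.\<close>

lemma norm_deriv_deriv_le_of_univalent:
  obtains K :: real where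
    "\<And>H. H holomorphic_on unit_disc \<Longrightarrow> inj_on H unit_disc \<Longrightarrow>
       norm (deriv (deriv H) 0) \<le> K * norm (deriv H 0)"
proof -
  \<comment> \<open>Schottky's bound for a function of modulus at most 1 at the origin, evaluated on
    the disc of radius 1/2.\<close>
  define M :: real where "M = exp (pi * exp (pi * (2 + 2 * 1 + 12 * (1/2) / (1 - 1/2))))"
  show ?thesis
  proof (rule that)
    fix H assume hol: "H holomorphic_on unit_disc" and inj: "inj_on H unit_disc"
    obtain w where w: "w \<notin> H ` unit_disc" "norm (w - H 0) \<le> 2 * norm (deriv H 0)"
      using exists_omitted_value[OF hol inj] by blast
    have w0: "w - H 0 \<noteq> 0" using w(1) by auto
    define q where "q = (\<lambda>z. (w - H z) / (w - H 0))"
    have qhol: "q holomorphic_on unit_disc" unfolding q_def using w0 by (intro holomorphic_intros hol) auto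
    have qnz: "q z \<noteq> 0" if "z \<in> unit_disc" for z using w(1) w0 that by (auto simp: q_def)
    obtain s where s: "s holomorphic_on unit_disc" "\<And>z. z \<in> unit_disc \<Longrightarrow> q z = s z ^ 2"
      using contractible_imp_holomorphic_sqrt[OF qhol convex_imp_contractible qnz] by auto
    have s0: "s 0 ^ 2 = 1" using s(2)[of 0] w0 by (simp add: q_def)
    have s0nz: "s 0 \<noteq> 0" using s0 by auto
    define f where "f = (\<lambda>z. - s z / s 0)"
    have f0: "f 0 = -1" using s0nz by (simp add: f_def)
    have f2: "f z ^ 2 = q z" if "z \<in> unit_disc" for z
      using s(2)[OF that] s0 by (simp add: f_def power_divide)
    have fhol: "f holomorphic_on unit_disc" unfolding f_def using s0nz by (intro holomorphic_intros s(1)) auto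
    have f01: "\<not> (f z = 0 \<or> f z = 1)" if z: "z \<in> unit_disc" for z
    proof
      assume "f z = 0 \<or> f z = 1"
      then have "f z = 1" using f2[OF z] qnz[OF z] by auto
      with f2[OF z] have "H z = H 0" using w0 by (simp add: q_def)
      then have "z = 0" using inj_onD[OF inj] z by simp
      with \<open>f z = 1\<close> f0 show False by simp
    qed
    have fM: "norm (f z) \<le> M" if z: "norm z \<le> 1/4" for z
    proof -
      \<comment> \<open>Schottky's theorem asks for holomorphy on the closed unit disc, so
        \<open>f\<close> is rescaled by 1/2; the radius 1/2 then becomes 1/4 for
        \<open>f\<close>.\<close>
      have "norm ((\<lambda>z. f (z / 2)) (2 * z)) \<le> exp (pi * exp (pi * (2 + 2 * 1 + 12 * (1/2) / (1 - 1/2))))"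
      proof (rule Schottky[where f = "\<lambda>z. f (z / 2)"])
        have "(f \<circ> (\<lambda>z. z / 2)) holomorphic_on cball 0 1"
          by (rule holomorphic_on_compose_gen[OF _ fhol]) (auto intro!: holomorphic_intros simp: norm_divide)
        then show "(\<lambda>z. f (z / 2)) holomorphic_on cball 0 1" by (simp add: comp_def)
        show "norm (f (0 / 2)) \<le> 1" by (simp add: f0)
        show "\<not> (f (z / 2) = 0 \<or> f (z / 2) = 1)" if "z \<in> cball 0 1" for z
          using f01[of "z / 2"] that by (auto simp: norm_divide)
        show "norm (2 * z) \<le> 1 / 2" using z by (simp add: norm_mult)
      qed auto
      then show ?thesis by (simp add: M_def)
    qed
    have Mpos: "M > 0" by (simp add: M_def)
    \<comment> \<open>Cauchy's estimate with values centred at the omitted \<open>w\<close>, as |w -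
      H z| = |w - H 0| |f z|^2. The summand 1 places the values in an open ball.\<close>
    have "norm ((deriv ^^ 2) H 0) \<le> fact 2 * (norm (w - H 0) * (M\<^sup>2 + 1)) / (1/4) ^ 2"
    proof (rule Cauchy_higher_deriv_bound[where y = w])
      show "H holomorphic_on ball 0 (1/4)" by (rule holomorphic_on_subset[OF hol]) auto
      show "continuous_on (cball 0 (1/4)) H"
        by (rule continuous_on_subset[OF holomorphic_on_imp_continuous_on[OF hol]]) auto
      fix z :: complex assume z: "z \<in> ball 0 (1/4)"
      then have "norm (q z) = norm (f z) ^ 2" using f2[of z] by (simp flip: norm_power)
      also have "\<dots> \<le> M\<^sup>2" using fM[of z] z by (intro power_mono) auto
      finally have "norm (w - H 0) * norm (q z) < norm (w - H 0) * (M\<^sup>2 + 1)"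
        using w0 by (intro mult_strict_left_mono) auto
      then show "H z \<in> ball w (norm (w - H 0) * (M\<^sup>2 + 1))"
        using w0 by (simp add: q_def norm_divide dist_norm)
    qed auto
    also have "\<dots> = 32 * (M\<^sup>2 + 1) * norm (w - H 0)" by (simp add: power2_eq_square)
    also have "\<dots> \<le> 32 * (M\<^sup>2 + 1) * (2 * norm (deriv H 0))"
      using w(2) by (intro mult_left_mono) auto
    finally show "norm (deriv (deriv H) 0) \<le> 32 * (M\<^sup>2 + 1) * 2 * norm (deriv H 0)"
      by (simp add: numeral_2_eq_2 algebra_simps)
  qed
qed

lemma order_of_map_eq: "order_of_map \<phi> = (SUP z\<in>unit_disc. norm (order_op \<phi> z))"
  by (simp add: order_of_map_def order_op_def)

text \<open>Moving each point to the origin reduces the expression to H''(0) / (2 H'(0)) for a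
  univalent \<open>H\<close>, which has a universal bound. The set is thus bounded above and the
  real supremum is a true one.\<close>

lemma norm_order_op_le_order_of_map:
  assumes hol: "h holomorphic_on unit_disc" and inj: "inj_on h unit_disc" and z: "z \<in> unit_disc"
  shows "norm (order_op h z) \<le> order_of_map h"
proof -
  obtain K where K: "\<And>H. H holomorphic_on unit_disc \<Longrightarrow> inj_on H unit_disc \<Longrightarrow>
       norm (deriv (deriv H) 0) \<le> K * norm (deriv H 0)"
    using norm_deriv_deriv_le_of_univalent by blast
  have nz: "\<And>z. z \<in> unit_disc \<Longrightarrow> deriv h z \<noteq> 0"
    using holomorphic_injective_imp_regular[OF hol _ inj] by simp
  have "norm (order_op h a) \<le> K / 2" if a: "a \<in> unit_disc" for a
  proof -
    define H where "H = (\<lambda>z. h (Moebius_function 0 (- a) z))"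
    have H: "H holomorphic_on unit_disc" "inj_on H unit_disc"
      unfolding H_def using hol inj a
      by (auto intro!: holomorphic_compose_Moebius inj_on_compose_Moebius)
    have H0: "deriv H 0 \<noteq> 0" using holomorphic_injective_imp_regular[OF H(1) _ H(2)] by simp
    have "norm (order_op h a) = norm (order_op H 0)"
      using norm_order_op_compose_Moebius[OF hol a _ nz, of 0]
      by (simp add: H_def Moebius_function_0_minus)
    also have "\<dots> = norm (deriv (deriv H) 0) / norm (deriv H 0) / 2"
      by (simp add: order_op_def norm_divide)
    also have "\<dots> \<le> K / 2" using K[OF H] H0 by (simp add: divide_simps)
    finally show ?thesis .
  qed
  then have "bdd_above ((\<lambda>z. norm (order_op h z)) ` unit_disc)"
    by (intro bdd_aboveI2)
  then show ?thesis unfolding order_of_map_eq using z by (rule cSUP_upper2) auto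
qed

text \<open>If the order were \<open>0\<close>, the conformal radius would be constant, so \<open>1 / deriv h\<close> would violate
  the maximum principle on a circle about the origin.\<close>

lemma order_of_map_pos:
  assumes hol: "h holomorphic_on unit_disc" and inj: "inj_on h unit_disc"
  shows "order_of_map h > 0"
proof (rule ccontr)
  assume neg: "\<not> order_of_map h > 0"
  have nz: "\<And>z. z \<in> unit_disc \<Longrightarrow> deriv h z \<noteq> 0"
    using holomorphic_injective_imp_regular[OF hol _ inj] by simp
  have le: "norm (order_op h z) \<le> 0" if "z \<in> unit_disc" for z
    using norm_order_op_le_order_of_map[OF hol inj that] neg by linarith
  \<comment> \<open>Cauchy's inequality of order zero serves as the maximum principle on the circle
    of radius 1/2, where \<open>1 - (norm x)^2\<close> equals 3/4.\<close>
  have "norm ((deriv ^^ 0) (\<lambda>z. 1 / deriv h z) 0) \<le> fact 0 * (3/4 / norm (deriv h 0)) / (1/2) ^ 0"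
  proof (rule Cauchy_inequality)
    have *: "(\<lambda>z. 1 / deriv h z) holomorphic_on unit_disc"
      using nz by (intro holomorphic_intros hol) auto
    show "(\<lambda>z. 1 / deriv h z) holomorphic_on ball 0 (1/2)"
      by (rule holomorphic_on_subset[OF *]) auto
    show "continuous_on (cball 0 (1/2)) (\<lambda>z. 1 / deriv h z)"
      by (rule continuous_on_subset[OF holomorphic_on_imp_continuous_on[OF *]]) auto
    fix x :: complex assume "norm (0 - x) = 1/2"
    then have x: "norm x = 1/2" by simp
    then have "norm (deriv h 0) \<le> conf_radius h x"
      using conf_radius_bounds(1)[OF hol nz le, of x] by simp
    also have "\<dots> = 3/4 * norm (deriv h x)" unfolding conf_radius_def x by (simp add: power2_eq_square)
    finally show "norm (1 / deriv h x) \<le> 3/4 / norm (deriv h 0)"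
      using nz[of 0] nz[of x] x by (simp add: norm_divide divide_simps)
  qed simp
  then show False using nz[of 0] by (simp add: norm_divide field_simps)
qed

section \<open>Two-point distortion for the analytic part\<close>

text \<open>The automorphism sending 0 to \<open>a\<close> reduces this to the estimates from the
  origin: the order bound persists, |H'(0)| is the conformal radius at \<open>a\<close>, and the
  preimage of \<open>b\<close> has norm \<open>pseudohyp_dist a b\<close>.\<close>

lemma two_point_distortion_aux:
  assumes hol: "h holomorphic_on unit_disc" and inj: "inj_on h unit_disc"
    and \<beta>: "\<beta> = order_of_map h" and a: "a \<in> unit_disc" and b: "b \<in> unit_disc"
  shows "conf_radius h a * ((1 - exp (- 2 * \<beta> * hyp_dist a b)) / (2 * \<beta>)) \<le> norm (h a - h b)"
    and "norm (h a - h b) \<le> conf_radius h a * ((exp (2 * \<beta> * hyp_dist a b) - 1) / (2 * \<beta>))"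
proof -
  define H where "H = (\<lambda>z. h (Moebius_function 0 (- a) z))"
  have H: "H holomorphic_on unit_disc" "inj_on H unit_disc"
    unfolding H_def using hol inj a
    by (auto intro!: holomorphic_compose_Moebius inj_on_compose_Moebius)
  have nz: "\<And>z. z \<in> unit_disc \<Longrightarrow> deriv h z \<noteq> 0" "\<And>z. z \<in> unit_disc \<Longrightarrow> deriv H z \<noteq> 0"
    using holomorphic_injective_imp_regular[OF hol _ inj] holomorphic_injective_imp_regular[OF H(1) _ H(2)]
    by simp_all
  have bd: "norm (order_op H z) \<le> \<beta>" if "z \<in> unit_disc" for z
    using norm_order_op_compose_Moebius[OF hol a that nz(1)]
      norm_order_op_le_order_of_map[OF hol inj Moebius_in_disc[OF a that]]
    by (simp add: H_def \<beta>)
  have \<beta>pos: "\<beta> > 0" using order_of_map_pos[OF hol inj] \<beta> by simp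
  define z where "z = Moebius_function 0 a b"
  have z: "z \<in> unit_disc" using Moebius_function_norm_lt_1[of a b 0] a b by (simp add: z_def)
  have "norm z = pseudohyp_dist a b"
    by (simp add: z_def Moebius_function_simple pseudohyp_dist_def norm_divide norm_minus_commute)
  then have d: "hyp_dist a b = artanh (norm z)" by (simp add: hyp_dist_def)
  have Hz: "H z = h b"
    using Moebius_function_compose[of "- a" a b] a b by (simp add: H_def z_def)
  have H0: "H 0 = h a" by (simp add: H_def Moebius_function_0_minus)
  have "conf_radius H 0 = conf_radius h a"
    using conf_radius_compose_Moebius[OF hol a, of 0] by (simp add: H_def Moebius_function_0_minus)
  then have R: "norm (deriv H 0) = conf_radius h a" by (simp add: conf_radius_def)
  show "conf_radius h a * ((1 - exp (- 2 * \<beta> * hyp_dist a b)) / (2 * \<beta>)) \<le> norm (h a - h b)"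
    using norm_diff_0_ge_of_order[OF H bd z \<beta>pos] by (simp add: R d Hz H0 norm_minus_commute)
  show "norm (h a - h b) \<le> conf_radius h a * ((exp (2 * \<beta> * hyp_dist a b) - 1) / (2 * \<beta>))"
    using norm_diff_0_le_of_order[OF H(1) nz(2) bd z \<beta>pos] by (simp add: R d Hz H0 norm_minus_commute)
qed

lemma hyp_dist_commute: "hyp_dist a b = hyp_dist b a"
proof -
  have "1 - cnj a * b = cnj (1 - cnj b * a)" by simp
  then have "norm (1 - cnj a * b) = norm (1 - cnj b * a)" by (simp only: complex_mod_cnj)
  then show ?thesis by (simp add: hyp_dist_def pseudohyp_dist_def norm_divide norm_minus_commute)
qed

text \<open>For nonnegative \<open>K\<close> the two inequalities are multiplied and a root is
  taken; for negative \<open>K\<close> the left-hand side is at most 0.\<close>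

lemma mult_le_geometric_mean:
  fixes x y K M :: real
  assumes "x * K \<le> M" "y * K \<le> M" "x \<ge> 0" "y \<ge> 0" "M \<ge> 0"
  shows "sqrt (x * y) * K \<le> M"
proof (cases "K \<ge> 0")
  case True
  have "(sqrt (x * y) * K)\<^sup>2 = (x * K) * (y * K)"
    using assms by (simp add: power_mult_distrib power2_eq_square)
  also have "\<dots> \<le> M\<^sup>2"
    unfolding power2_eq_square using assms True by (intro mult_mono mult_nonneg_nonneg)
  finally show ?thesis using assms(5) by (rule power2_le_imp_le)
next
  case False
  then have "sqrt (x * y) * K \<le> 0" using assms by (simp add: mult_nonneg_nonpos)
  then show ?thesis using assms by linarith
qed

lemma geometric_mean_le_mult:
  fixes x y K M :: real
  assumes "M \<le> x * K" "M \<le> y * K" "x \<ge> 0" "y \<ge> 0" "M \<ge> 0" "K \<ge> 0"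
  shows "M \<le> sqrt (x * y) * K"
proof -
  have "M\<^sup>2 \<le> (x * K) * (y * K)"
    unfolding power2_eq_square using assms by (intro mult_mono mult_nonneg_nonneg)
  also have "\<dots> = (sqrt (x * y) * K)\<^sup>2"
    using assms by (simp add: power_mult_distrib power2_eq_square)
  finally show ?thesis by (rule power2_le_imp_le) (simp add: assms)
qed

lemma two_point_distortion:
  assumes hol: "h holomorphic_on unit_disc" and inj: "inj_on h unit_disc"
    and \<beta>: "\<beta> = order_of_map h" and a: "a \<in> unit_disc" and b: "b \<in> unit_disc"
  shows "sqrt (conf_radius h a * conf_radius h b) * ((1 - exp (- 2 * \<beta> * hyp_dist a b)) / (2 * \<beta>))
           \<le> norm (h a - h b)" (is ?lower)
    and "norm (h a - h b) \<le>
           sqrt (conf_radius h a * conf_radius h b) * ((exp (2 * \<beta> * hyp_dist a b) - 1) / (2 * \<beta>))" (is ?upper)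
proof -
  have R: "conf_radius h z > 0" if "z \<in> unit_disc" for z
    using that holomorphic_injective_imp_regular[OF hol _ inj that]
    by (simp add: conf_radius_def power_less_one_iff abs_square_less_1)
  note ab = two_point_distortion_aux[OF hol inj \<beta> a b]
  note ba = two_point_distortion_aux[OF hol inj \<beta> b a, unfolded hyp_dist_commute[of b a] norm_minus_commute[of "h b"]]
  show ?lower
    using ab(1) ba(1) R[OF a] R[OF b] by (intro mult_le_geometric_mean) auto
  \<comment> \<open>The sign of the factor is read off the upper estimate itself, which bounds a
    norm by this factor times a positive conformal radius.\<close>
  have "0 \<le> conf_radius h a * ((exp (2 * \<beta> * hyp_dist a b) - 1) / (2 * \<beta>))"
    using ab(2) norm_ge_zero order_trans by blast
  then have "0 \<le> (exp (2 * \<beta> * hyp_dist a b) - 1) / (2 * \<beta>)"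
    using R[OF a] zero_le_mult_iff by (metis less_le_not_le)
  then show ?upper
    using ab(2) ba(2) R[OF a] R[OF b] by (intro geometric_mean_le_mult) auto
qed

section \<open>Control of the co-analytic part by linear connectedness\<close>

text \<open>Fine partitions of the curve are inscribed in chains of balls contained in \<open>S\<close>, on each of which
  the mean value inequality applies.\<close>

lemma norm_diff_le_curve_length:
  assumes G: "G holomorphic_on S" and S: "open S"
    and M: "\<And>z. z \<in> S \<Longrightarrow> norm (deriv G z) \<le> M" and M0: "M \<ge> 0"
    and \<gamma>: "path \<gamma>" "path_image \<gamma> \<subseteq> S" and L: "curve_length \<gamma> \<le> ereal L"
  shows "norm (G (pathfinish \<gamma>) - G (pathstart \<gamma>)) \<le> M * L"
proof -
  obtain e where e: "e > 0" "(\<Union>x\<in>path_image \<gamma>. ball x e) \<subseteq> S"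
    using compact_subset_open_imp_ball_epsilon_subset[OF compact_path_image[OF \<gamma>(1)] S \<gamma>(2)] by blast
  have "uniformly_continuous_on {0..1} \<gamma>"
    using \<gamma>(1) by (simp add: path_def compact_uniformly_continuous)
  then obtain \<delta> where \<delta>: "\<delta> > 0"
    "\<And>s t. \<lbrakk>s \<in> {0..1}; t \<in> {0..1}; dist s t < \<delta>\<rbrakk> \<Longrightarrow> dist (\<gamma> s) (\<gamma> t) < e"
    using e(1) unfolding uniformly_continuous_on_def by metis
  obtain n :: nat where n: "n > 0" "inverse (real n) < \<delta>"
    using ex_inverse_of_nat_less[OF \<delta>(1)] by auto
  define t where "t = (\<lambda>i. real i / real n)"
  have step: "norm (G (\<gamma> (t (Suc i))) - G (\<gamma> (t i))) \<le> M * dist (\<gamma> (t i)) (\<gamma> (t (Suc i)))"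
    if i: "i < n" for i
  proof -
    have t01: "t i \<in> {0..1}" "t (Suc i) \<in> {0..1}" using i n by (auto simp: t_def)
    have "dist (t i) (t (Suc i)) = inverse (real n)"
      using n by (simp add: t_def dist_real_def field_simps)
    then have near: "dist (\<gamma> (t i)) (\<gamma> (t (Suc i))) < e" using \<delta>(2)[OF t01] n by simp
    have "\<gamma> (t i) \<in> path_image \<gamma>" using t01 by (simp add: path_image_def)
    then have ball: "ball (\<gamma> (t i)) e \<subseteq> S" using e(2) by blast
    have "norm (G (\<gamma> (t (Suc i))) - G (\<gamma> (t i))) \<le> M * norm (\<gamma> (t (Suc i)) - \<gamma> (t i))"
    proof (rule field_differentiable_bound[where S = "ball (\<gamma> (t i)) e"])
      show "(G has_field_derivative deriv G z) (at z within ball (\<gamma> (t i)) e)"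
        if "z \<in> ball (\<gamma> (t i)) e" for z
        using holomorphic_derivI[OF G S] ball that by blast
    qed (use ball near e M in auto)
    then show ?thesis by (simp add: dist_norm norm_minus_commute)
  qed
  \<comment> \<open>The equidistant partition is a competitor in the supremum defining
    \<open>curve_length\<close>.\<close>
  have "t 0 = 0" "t n = 1" "mono_on {..n} t"
    using n by (auto simp: t_def mono_on_def divide_right_mono)
  then have "ereal (\<Sum>i<n. dist (\<gamma> (t i)) (\<gamma> (t (Suc i)))) \<le> curve_length \<gamma>"
    unfolding curve_length_def by (intro SUP_upper2[of "(n, t)"]) auto
  then have sumL: "(\<Sum>i<n. dist (\<gamma> (t i)) (\<gamma> (t (Suc i)))) \<le> L"
    using L by (metis ereal_less_eq(3) order_trans)
  have "G (pathfinish \<gamma>) - G (pathstart \<gamma>) = (\<Sum>i<n. G (\<gamma> (t (Suc i))) - G (\<gamma> (t i)))"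
    using \<open>t 0 = 0\<close> \<open>t n = 1\<close> sum_lessThan_telescope[of "\<lambda>i. G (\<gamma> (t i))" n]
    by (simp add: pathfinish_def pathstart_def)
  also have "norm \<dots> \<le> (\<Sum>i<n. M * dist (\<gamma> (t i)) (\<gamma> (t (Suc i))))"
    using step by (intro sum_norm_le) auto
  also have "\<dots> \<le> M * L"
    using sumL M0 by (simp add: mult_left_mono flip: sum_distrib_left)
  finally show ?thesis .
qed

text \<open>A positive Jacobian bounds the dilatation by 1, so the real supremum is taken over a
  bounded set.\<close>

lemma norm_dilatation_le:
  assumes "sense_preserving h g" "z \<in> unit_disc"
  shows "norm (dilatation h g z) \<le> disc_sup_norm (dilatation h g)"
proof -
  have "norm (dilatation h g z) \<le> 1" if "z \<in> unit_disc" for z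
  proof -
    have "(norm (deriv g z))\<^sup>2 < (norm (deriv h z))\<^sup>2"
      using assms(1) that by (auto simp: sense_preserving_def jacobian_def)
    then have "norm (deriv g z) < norm (deriv h z)" by (rule power2_less_imp_less) simp
    then show ?thesis by (simp add: dilatation_def norm_divide divide_le_eq_1)
  qed
  then have "bdd_above ((\<lambda>z. norm (dilatation h g z)) ` unit_disc)" by (intro bdd_aboveI2)
  then show ?thesis unfolding disc_sup_norm_def using assms(2) by (rule cSUP_upper2) auto
qed

text \<open>The function \<open>g \<circ> h\<^sup>-\<^sup>1\<close> has derivative \<open>\<omega> \<circ> h\<^sup>-\<^sup>1\<close> on the image of \<open>h\<close>.\<close>

lemma norm_coanalytic_part_le:
  assumes hol: "h holomorphic_on unit_disc" "g holomorphic_on unit_disc" and inj: "inj_on h unit_disc"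
    and sp: "sense_preserving h g" and lc: "linearly_connected c h"
    and a: "a \<in> unit_disc" and b: "b \<in> unit_disc"
  shows "norm (g a - g b) \<le> c * disc_sup_norm (dilatation h g) * norm (h a - h b)"
proof -
  define M where "M = disc_sup_norm (dilatation h g)"
  have M0: "M \<ge> 0" using norm_dilatation_le[OF sp a] norm_ge_zero[of "dilatation h g a"] unfolding M_def by linarith
  obtain k where k: "k holomorphic_on h ` unit_disc"
    and dk: "\<And>z. z \<in> unit_disc \<Longrightarrow> deriv h z * deriv k (h z) = 1"
    and kh: "\<And>z. z \<in> unit_disc \<Longrightarrow> k (h z) = z"
    using holomorphic_has_inverse[OF hol(1) _ inj] by (metis open_ball)
  have opn: "open (h ` unit_disc)" using open_mapping_thm3[OF hol(1) _ inj] by simp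
  have G: "(g \<circ> k) holomorphic_on h ` unit_disc"
    using kh by (intro holomorphic_on_compose_gen[OF k hol(2)]) auto
  have dG: "norm (deriv (g \<circ> k) w) \<le> M" if w: "w \<in> h ` unit_disc" for w
  proof -
    obtain z where z: "z \<in> unit_disc" "w = h z" using w by blast
    have "((g \<circ> k) has_field_derivative deriv g z * deriv k (h z)) (at w)"
      using DERIV_chain[OF holomorphic_derivI[OF hol(2) open_ball] holomorphic_derivI[OF k opn w]] kh z
      by simp
    then have "deriv (g \<circ> k) w = deriv g z * deriv k (h z)" by (rule DERIV_imp_deriv)
    also have "\<dots> = dilatation h g z"
    proof -
      have "deriv h z \<noteq> 0" using dk[OF z(1)] by auto
      then have "deriv k (h z) = 1 / deriv h z"
        using dk[OF z(1)] by (simp add: eq_divide_eq mult.commute)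
      then show ?thesis by (simp add: dilatation_def)
    qed
    finally show ?thesis using norm_dilatation_le[OF sp z(1)] by (simp add: M_def)
  qed
  obtain \<gamma> where \<gamma>: "path \<gamma>" "path_image \<gamma> \<subseteq> h ` unit_disc" "pathstart \<gamma> = h a" "pathfinish \<gamma> = h b"
    "curve_length \<gamma> \<le> ereal (c * norm (h a - h b))"
    using lc a b unfolding linearly_connected_def by blast
  show ?thesis
    using norm_diff_le_curve_length[OF G opn dG M0 \<gamma>(1,2,5)] kh[OF a] kh[OF b]
    by (simp add: \<gamma> M_def norm_minus_commute mult_ac)
qed

section \<open>Combination of the analytic and co-analytic parts\<close>

theorem theorem7:
  fixes c \<beta> :: real and f h g \<omega> :: "complex \<Rightarrow> complex"
  assumes "c \<ge> 1"
    and "harmonic_mapping f h g"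
    and "sense_preserving h g"
    and "conformal_on_disc h"
    and "linearly_connected c h"
    and "\<omega> = dilatation h g"
    and "disc_sup_norm \<omega> < 1 / c"
    and "\<beta> = order_of_map h"
    and "a \<in> unit_disc" and "b \<in> unit_disc"
  shows "norm (f a - f b) \<ge> (1 - c * disc_sup_norm \<omega>) * (1 / (2 * \<beta>))
             * (1 - exp (- 2 * \<beta> * hyp_dist a b)) * sqrt (conf_radius h a * conf_radius h b)
       \<and> norm (f a - f b) \<le> (1 + c * disc_sup_norm \<omega>) * (1 / (2 * \<beta>))
             * (exp (2 * \<beta> * hyp_dist a b) - 1) * sqrt (conf_radius h a * conf_radius h b)"
proof -
  define \<kappa> where "\<kappa> = c * disc_sup_norm \<omega>"
  have hol: "h holomorphic_on unit_disc" "g holomorphic_on unit_disc" and inj: "inj_on h unit_disc"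
    and f: "f a - f b = (h a - h b) + cnj (g a - g b)"
    using assms(2,4,9,10) by (auto simp: harmonic_mapping_def conformal_on_disc_def)
  have g: "norm (cnj (g a - g b)) \<le> \<kappa> * norm (h a - h b)"
    using norm_coanalytic_part_le[OF hol inj assms(3,5,9,10)] assms(6) unfolding complex_mod_cnj \<kappa>_def by simp
  have \<kappa>: "\<kappa> < 1" using assms(1,7) by (simp add: \<kappa>_def field_simps)
  have "norm (dilatation h g a) \<le> disc_sup_norm \<omega>"
    using norm_dilatation_le[OF assms(3,9)] assms(6) by simp
  then have "0 \<le> disc_sup_norm \<omega>" using norm_ge_zero order_trans by blast
  then have \<kappa>0: "0 \<le> \<kappa>" using assms(1) by (simp add: \<kappa>_def)
  note td = two_point_distortion[OF hol(1) inj assms(8-10)]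
  \<comment> \<open>The bound \<open>disc_sup_norm \<omega> < 1 / c\<close> enters here: it makes
    \<open>1 - \<kappa>\<close> positive, so the lower estimate may be multiplied by it.\<close>
  have "(1 - \<kappa>) * (sqrt (conf_radius h a * conf_radius h b) * ((1 - exp (- 2 * \<beta> * hyp_dist a b)) / (2 * \<beta>)))
     \<le> (1 - \<kappa>) * norm (h a - h b)"
    using td(1) \<kappa> by (intro mult_left_mono) auto
  also have "\<dots> \<le> norm (f a - f b)"
    using g norm_diff_ineq[of "h a - h b" "cnj (g a - g b)"] unfolding f by (simp add: algebra_simps)
  finally have lower: "(1 - \<kappa>) * (sqrt (conf_radius h a * conf_radius h b) * ((1 - exp (- 2 * \<beta> * hyp_dist a b)) / (2 * \<beta>)))
     \<le> norm (f a - f b)" .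
  have "norm (f a - f b) \<le> (1 + \<kappa>) * norm (h a - h b)"
    using g norm_triangle_ineq[of "h a - h b" "cnj (g a - g b)"] unfolding f by (simp add: algebra_simps)
  also have "\<dots> \<le> (1 + \<kappa>) * (sqrt (conf_radius h a * conf_radius h b) * ((exp (2 * \<beta> * hyp_dist a b) - 1) / (2 * \<beta>)))"
    using td(2) \<kappa>0 by (intro mult_left_mono) auto
  finally have "norm (f a - f b) \<le> \<dots>" .
  with lower show ?thesis unfolding \<kappa>_def[symmetric] by (simp add: mult_ac)
qed

end
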